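(* Let $A$ be a residuated lattice and let $\mathcal{L}(A)$ be (the bounded distributive lattice of) its reticulation. The following are equivalent: (1) the residuated lattice $A$ has the Boolean Lifting Property (BLP); (2) the bounded distributive lattice $\mathcal{L}(A)$ has the Boolean Lifting Property (BLP).
   Context: A residuated lattice is an algebra $(A,\vee,\wedge,\odot,\rightarrow,0,1)$ such that $(A,\vee,\wedge,0,1)$ is a bounded lattice (with order $\leq$), $(A,\odot,1)$ is a commutative monoid, and $a\leq b\rightarrow c$ iff $a\odot b\leq c$ for all $a,b,c$. Put $a\leftrightarrow b=(a\rightarrow b)\wedge(b\rightarrow a)$; $a^n$ is the $n$-fold $\odot$-power and $\mathbb{N}^*$ the nonzero naturals. For a residuated lattice or a bounded distributive lattice $X$, $\mathcal{B}(X)$ is the set of complemented elements of the underlying bounded lattice. A filter of a residuated lattice $A$ is a non-empty subset closed under $\odot$ and upward closed; for a filter $F$, the congruence modulo $F$ is $x\equiv y$ iff $x\leftrightarrow y\in F$. A filter of a bounded distributive lattice $L$ is a non-empty subset closed under $\wedge$ and upward closed; for a filter $F$, the congruence modulo $F$ is $x\equiv y$ iff $x\wedge a=y\wedge a$ for some $a\in F$. In either case $X/F$ is the quotient algebra, $x/F$ the class of $x$, $\mathcal{B}(X)/F=\{e/F\mid e\in\mathcal{B}(X)\}$; $F$ has BLP iff $\mathcal{B}(X/F)=\mathcal{B}(X)/F$, and $X$ has BLP iff every filter of $X$ has BLP. The reticulation of $A$ is a pair $(\mathcal{L}(A),\lambda)$, unique up to bounded lattice isomorphism (compatible with $\lambda$),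 where $\mathcal{L}(A)$ is a bounded distributive lattice and $\lambda:A\to\mathcal{L}(A)$ is a surjection with $\lambda(a\odot b)=\lambda(a)\wedge\lambda(b)$, $\lambda(a\vee b)=\lambda(a)\vee\lambda(b)$, $\lambda(0)=0$, $\lambda(1)=1$, and $\lambda(a)\leq\lambda(b)$ iff $a^n\leq b$ for some $n\in\mathbb{N}^*$. *)

theory Defs
  imports Main
begin

text \<open>Carriers are types. The two roles of \<open>1\<close> (greatest element, monoid unit) belong to
  different library constants, so they are identified by an axiom; \<open>a \<odot> b\<close> is \<open>a * b\<close>,
  \<open>a \<rightarrow> b\<close> is \<open>residuum a b\<close>, and \<open>0\<close>, \<open>1\<close> are \<open>bot\<close>, \<open>top\<close>. Nontriviality (\<open>0 \<noteq> 1\<close>) is not assumed.\<close>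

class residuated_lattice = bounded_lattice + comm_monoid_mult +
  fixes residuum :: "'a \<Rightarrow> 'a \<Rightarrow> 'a"
  assumes one_eq_top: "1 = top"
    and residuation: "a \<le> residuum b c \<longleftrightarrow> a * b \<le> c"

definition biresiduum :: "'a::residuated_lattice \<Rightarrow> 'a \<Rightarrow> 'a" where
  "biresiduum a b = inf (residuum a b) (residuum b a)"

subsection \<open>Complemented elements and quotients\<close>

text \<open>The operations are explicit so that the same notion applies to a lattice on a whole type and
  to a quotient, whose carrier is a set of classes.\<close>

record 'a bounded_lattice_ops =
  carrier :: "'a set"
  join :: "'a \<Rightarrow> 'a \<Rightarrow> 'a"
  meet :: "'a \<Rightarrow> 'a \<Rightarrow> 'a"
  zero :: 'a
  unit :: 'a

definition complemented_elements :: "'a bounded_lattice_ops \<Rightarrow> 'a set" where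
  "complemented_elements X =
     {x \<in> carrier X. \<exists>y \<in> carrier X. join X x y = unit X \<and> meet X x y = zero X}"

definition lattice_of_type :: "'a::bounded_lattice bounded_lattice_ops" where
  "lattice_of_type =
     \<lparr>carrier = UNIV, join = sup, meet = inf, zero = bot, unit = top\<rparr>"

definition class_op :: "('a \<times> 'a) set \<Rightarrow> ('a \<Rightarrow> 'a \<Rightarrow> 'a) \<Rightarrow> 'a set \<Rightarrow> 'a set \<Rightarrow> 'a set" where
  "class_op r f X Y = (\<Union>x\<in>X. \<Union>y\<in>Y. r `` {f x y})"

text \<open>The underlying bounded lattice of the quotient algebra modulo a congruence \<open>r\<close>. For
  residuated lattices the quotients of \<open>\<odot>\<close> and \<open>\<rightarrow>\<close> are left out, as complemented elements
  depend on the lattice reduct only.\<close>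

definition quotient_lattice ::
  "('a::bounded_lattice \<times> 'a) set \<Rightarrow> 'a set bounded_lattice_ops" where
  "quotient_lattice r =
     \<lparr>carrier = UNIV // r, join = class_op r sup, meet = class_op r inf,
      zero = r `` {bot}, unit = r `` {top}\<rparr>"

definition boolean_lifting :: "('a::bounded_lattice \<times> 'a) set \<Rightarrow> bool" where
  "boolean_lifting r \<longleftrightarrow>
     complemented_elements (quotient_lattice r) =
       {r `` {e} | e. e \<in> complemented_elements lattice_of_type}"

subsection \<open>Filters, their congruences, and BLP\<close>

definition residuated_filter :: "'a::residuated_lattice set \<Rightarrow> bool" where
  "residuated_filter F \<longleftrightarrow>
     F \<noteq> {} \<and> (\<forall>a\<in>F. \<forall>b\<in>F. a * b \<in> F) \<and> (\<forall>a\<in>F. \<forall>b. a \<le> b \<longrightarrow> b \<in> F)"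

definition residuated_cong :: "'a::residuated_lattice set \<Rightarrow> ('a \<times> 'a) set" where
  "residuated_cong F = {(x, y). biresiduum x y \<in> F}"

definition residuated_BLP :: "'a::residuated_lattice itself \<Rightarrow> bool" where
  "residuated_BLP _ \<longleftrightarrow>
     (\<forall>F :: 'a set. residuated_filter F \<longrightarrow> boolean_lifting (residuated_cong F))"

definition lattice_filter :: "'a::{distrib_lattice, bounded_lattice} set \<Rightarrow> bool" where
  "lattice_filter F \<longleftrightarrow>
     F \<noteq> {} \<and> (\<forall>a\<in>F. \<forall>b\<in>F. inf a b \<in> F) \<and> (\<forall>a\<in>F. \<forall>b. a \<le> b \<longrightarrow> b \<in> F)"

definition lattice_cong :: "'a::{distrib_lattice, bounded_lattice} set \<Rightarrow> ('a \<times> 'a) set" where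
  "lattice_cong F = {(x, y). \<exists>a\<in>F. inf x a = inf y a}"

definition lattice_BLP :: "'a::{distrib_lattice, bounded_lattice} itself \<Rightarrow> bool" where
  "lattice_BLP _ \<longleftrightarrow>
     (\<forall>F :: 'a set. lattice_filter F \<longrightarrow> boolean_lifting (lattice_cong F))"

subsection \<open>The reticulation\<close>

definition is_reticulation ::
  "('a::residuated_lattice \<Rightarrow> 'b::{distrib_lattice, bounded_lattice}) \<Rightarrow> bool" where
  "is_reticulation l \<longleftrightarrow>
     surj l \<and>
     (\<forall>a b. l (a * b) = inf (l a) (l b)) \<and>
     (\<forall>a b. l (sup a b) = sup (l a) (l b)) \<and>
     l bot = bot \<and> l top = top \<and>
     (\<forall>a b. l a \<le> l b \<longleftrightarrow> (\<exists>n>0. a ^ n \<le> b))"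

subsection \<open>The quotients are well defined\<close>

lemma class_op_classes:
  assumes "equiv UNIV r"
    and "\<And>x x' y y'. (x, x') \<in> r \<Longrightarrow> (y, y') \<in> r \<Longrightarrow> (f x y, f x' y') \<in> r"
  shows "class_op r f (r `` {x}) (r `` {y}) = r `` {f x y}"
proof -
  have "congruent2 r r (\<lambda>x y. r `` {f x y})"
    using assms by (auto simp: congruent2_def intro!: equiv_class_eq)
  from UN_equiv_class2[OF assms(1) assms(1) this] show ?thesis
    unfolding class_op_def by simp
qed

lemma lattice_cong_equiv:
  assumes "lattice_filter F"
  shows "equiv UNIV (lattice_cong F)"
proof (rule equivI)
  show "lattice_cong F \<subseteq> UNIV \<times> UNIV" by simp
  show "refl (lattice_cong F)"
    using assms by (auto simp: refl_on_def lattice_cong_def lattice_filter_def)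
  show "sym (lattice_cong F)"
    by (auto simp: sym_def lattice_cong_def) metis
  show "trans (lattice_cong F)"
  proof (rule transI)
    fix x y z assume "(x, y) \<in> lattice_cong F" "(y, z) \<in> lattice_cong F"
    then obtain a b where ab: "a \<in> F" "inf x a = inf y a" "b \<in> F" "inf y b = inf z b"
      by (auto simp: lattice_cong_def)
    then have "inf x (inf a b) = inf z (inf a b)"
      by (metis inf.assoc inf.commute)
    then show "(x, z) \<in> lattice_cong F"
      using ab assms by (auto simp: lattice_cong_def lattice_filter_def)
  qed
qed

lemma lattice_cong_compatible:
  assumes "lattice_filter F" and "(x, x') \<in> lattice_cong F" and "(y, y') \<in> lattice_cong F"
  shows "(sup x y, sup x' y') \<in> lattice_cong F" and "(inf x y, inf x' y') \<in> lattice_cong F"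
proof -
  obtain a b where ab: "a \<in> F" "inf x a = inf x' a" "b \<in> F" "inf y b = inf y' b"
    using assms by (auto simp: lattice_cong_def)
  have F: "inf a b \<in> F" using ab assms(1) by (auto simp: lattice_filter_def)
  have x: "inf x (inf a b) = inf x' (inf a b)" using ab by (metis inf.assoc)
  have y: "inf y (inf a b) = inf y' (inf a b)" using ab by (metis inf.assoc inf.commute)
  have "inf (sup x y) (inf a b) = inf (sup x' y') (inf a b)"
    by (simp only: inf_sup_distrib2 x y)
  then show "(sup x y, sup x' y') \<in> lattice_cong F" using F by (auto simp: lattice_cong_def)
  have "inf (inf x y) (inf a b) = inf (inf x' y') (inf a b)"
    using x y by (metis inf.assoc inf.commute)
  then show "(inf x y, inf x' y') \<in> lattice_cong F" using F by (auto simp: lattice_cong_def)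
qed

lemma residuated_mult_mono:
  fixes a b c d :: "'a::residuated_lattice"
  assumes "a \<le> b" and "c \<le> d"
  shows "a * c \<le> b * d"
proof -
  have "b \<le> residuum c (b * c)" "d \<le> residuum b (b * d)"
    by (simp_all add: residuation mult.commute)
  then have "a \<le> residuum c (b * c)" "c \<le> residuum b (b * d)"
    using assms order_trans by blast+
  then show ?thesis
    using order_trans by (auto simp: residuation mult.commute)
qed

lemma residuated_cong_iff:
  assumes "residuated_filter F"
  shows "(x, y) \<in> residuated_cong F \<longleftrightarrow> (\<exists>f\<in>F. f * x \<le> y \<and> f * y \<le> x)"
proof
  assume "(x, y) \<in> residuated_cong F"
  then have "biresiduum x y \<in> F" by (simp add: residuated_cong_def)
  moreover have "biresiduum x y * x \<le> y" "biresiduum x y * y \<le> x"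
    by (simp_all add: biresiduum_def flip: residuation)
  ultimately show "\<exists>f\<in>F. f * x \<le> y \<and> f * y \<le> x" by blast
next
  assume "\<exists>f\<in>F. f * x \<le> y \<and> f * y \<le> x"
  then obtain f where "f \<in> F" "f \<le> biresiduum x y"
    by (auto simp: biresiduum_def residuation)
  then show "(x, y) \<in> residuated_cong F"
    using assms by (auto simp: residuated_cong_def residuated_filter_def)
qed

lemma residuated_mult_le:
  fixes a b :: "'a::residuated_lattice"
  shows "a * b \<le> a" and "a * b \<le> b"
proof -
  have "x \<le> 1" for x :: 'a by (simp add: one_eq_top)
  then show "a * b \<le> a" "a * b \<le> b"
    using residuated_mult_mono[of a a b 1] residuated_mult_mono[of a 1 b b] by simp_all
qed

lemma residuated_cong_equiv:
  assumes "residuated_filter F"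
  shows "equiv UNIV (residuated_cong F)"
proof (rule equivI)
  show "residuated_cong F \<subseteq> UNIV \<times> UNIV" by simp
  show "refl (residuated_cong F)"
  proof (rule refl_onI)
    fix x
    obtain f where "f \<in> F" using assms by (auto simp: residuated_filter_def)
    then show "(x, x) \<in> residuated_cong F"
      using assms residuated_mult_le(2) by (auto simp: residuated_cong_iff)
  qed
  show "sym (residuated_cong F)"
    using assms by (auto simp: sym_def residuated_cong_iff)
  show "trans (residuated_cong F)"
  proof (rule transI)
    fix x y z assume "(x, y) \<in> residuated_cong F" "(y, z) \<in> residuated_cong F"
    then obtain f g where fg: "f \<in> F" "f * x \<le> y" "f * y \<le> x" "g \<in> F" "g * y \<le> z" "g * z \<le> y"
      using assms by (auto simp: residuated_cong_iff)
    have "g * (f * x) \<le> g * y" "f * (g * z) \<le> f * y"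
      using fg by (auto intro: residuated_mult_mono)
    then have "(f * g) * x \<le> z" "(f * g) * z \<le> x"
      using fg by (auto simp: ac_simps intro: order_trans)
    moreover have "f * g \<in> F" using fg assms by (auto simp: residuated_filter_def)
    ultimately show "(x, z) \<in> residuated_cong F"
      using assms by (auto simp: residuated_cong_iff)
  qed
qed

lemma residuated_cong_compatible:
  assumes "residuated_filter F"
    and "(x, x') \<in> residuated_cong F" and "(y, y') \<in> residuated_cong F"
  shows "(sup x y, sup x' y') \<in> residuated_cong F" and "(inf x y, inf x' y') \<in> residuated_cong F"
proof -
  obtain f g where fg: "f \<in> F" "f * x \<le> x'" "f * x' \<le> x" "g \<in> F" "g * y \<le> y'" "g * y' \<le> y"
    using assms by (auto simp: residuated_cong_iff)
  define h where "h = f * g"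
  have hF: "h \<in> F" using fg assms(1) by (auto simp: h_def residuated_filter_def)
  have hle: "h \<le> f" "h \<le> g" by (simp_all add: h_def residuated_mult_le)
  have h: "h * x \<le> x'" "h * x' \<le> x" "h * y \<le> y'" "h * y' \<le> y"
    using fg hle by (meson order_refl order_trans residuated_mult_mono)+
  have join: "h * sup u v \<le> sup u' v'" if "h * u \<le> u'" "h * v \<le> v'" for u v u' v'
  proof -
    have "u \<le> residuum h (sup u' v')" "v \<le> residuum h (sup u' v')"
      using that by (auto simp: residuation mult.commute intro: le_supI1 le_supI2)
    then have "sup u v \<le> residuum h (sup u' v')" by simp
    then show ?thesis by (simp add: residuation mult.commute)
  qed
  have meet: "h * inf u v \<le> inf u' v'" if "h * u \<le> u'" "h * v \<le> v'" for u v u' v'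
    using that by (meson inf.cobounded1 inf.cobounded2 le_inf_iff order_refl order_trans
        residuated_mult_mono)
  show "(sup x y, sup x' y') \<in> residuated_cong F" "(inf x y, inf x' y') \<in> residuated_cong F"
    unfolding residuated_cong_iff[OF assms(1)]
    using hF h by (blast intro: join meet)+
qed

end

theory Submission
  imports Defs
begin

text \<open>
  Let \<open>\<lambda>\<close> be the reticulation map. Every filter \<open>F\<close> of \<open>A\<close> has the form \<open>\<lambda>\<inverse>(G)\<close> for a filter \<open>G\<close> of
  \<open>\<L>(A)\<close>, and every \<open>\<lambda>\<inverse>(G)\<close> is a filter, so it suffices to show that \<open>F = \<lambda>\<inverse>(G)\<close> has BLP iff \<open>G\<close>
  does (\<open>boolean_lifting_reticulation_iff\<close>).

  The map \<open>\<lambda>\<close> is a homomorphism of bounded lattices and respects the two congruences, so it sends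
  complements modulo \<open>F\<close> to complements modulo \<open>G\<close>. What has to be overcome in the other direction is
  that \<open>\<lambda>\<close> does not distinguish \<open>x\<close> from its powers. Two facts show that complemented elements are
  not affected by this.

  \<^item> If \<open>\<lambda>(x)\<close> and \<open>\<lambda>(y)\<close> are complements modulo \<open>G\<close>, then for some \<open>n > 0\<close> the powers \<open>x\<^sup>n\<close> and \<open>y\<^sup>n\<close>
    are complements modulo \<open>F\<close>, and they still lie over \<open>\<lambda>(x)\<close> and \<open>\<lambda>(y)\<close>
    (\<open>reticulation_complementary_powers\<close>).
  \<^item> An element complemented modulo \<open>F\<close> is idempotent modulo \<open>F\<close>. Hence two such elements are
    congruent modulo \<open>F\<close> as soon as their images are congruent modulo \<open>G\<close>
    (\<open>reticulation_cong_reflect\<close>).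

  So \<open>\<lambda>\<close> induces a bijection between the complemented elements of \<open>A/F\<close> and those of \<open>\<L>(A)/G\<close>. For
  \<open>G = {1}\<close> this is a bijection between the complemented elements of \<open>A\<close> and those of \<open>\<L>(A)\<close>. The two
  bijections commute with passing to the quotients, so one of the quotient maps reaches all
  complemented elements exactly when the other does.
\<close>

section \<open>Lifting in terms of representatives\<close>

text \<open>The classes of \<open>x\<close> and \<open>y\<close> are complements in the quotient. For \<open>r = Id\<close> this says that \<open>x\<close> and
  \<open>y\<close> are complements in the lattice itself.\<close>

definition complementary_mod :: "('a::bounded_lattice \<times> 'a) set \<Rightarrow> 'a \<Rightarrow> 'a \<Rightarrow> bool" where
  "complementary_mod r x y \<longleftrightarrow> (sup x y, top) \<in> r \<and> (inf x y, bot) \<in> r"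

lemma complemented_elements_lattice_of_type:
  "e \<in> complemented_elements lattice_of_type \<longleftrightarrow> (\<exists>e'. complementary_mod Id e e')"
  by (simp add: complemented_elements_def lattice_of_type_def complementary_mod_def)

lemma complemented_elements_quotient_lattice:
  assumes equiv: "equiv UNIV r"
    and sup: "\<And>x x' y y'. (x, x') \<in> r \<Longrightarrow> (y, y') \<in> r \<Longrightarrow> (sup x y, sup x' y') \<in> r"
    and inf: "\<And>x x' y y'. (x, x') \<in> r \<Longrightarrow> (y, y') \<in> r \<Longrightarrow> (inf x y, inf x' y') \<in> r"
  shows "complemented_elements (quotient_lattice r) = {r `` {x} |x. \<exists>y. complementary_mod r x y}"
proof -
  have "class_op r sup (r `` {x}) (r `` {y}) = r `` {top} \<and>
        class_op r inf (r `` {x}) (r `` {y}) = r `` {bot} \<longleftrightarrow> complementary_mod r x y" for x y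
    by (simp add: class_op_classes[OF equiv sup] class_op_classes[OF equiv inf]
        eq_equiv_class_iff[OF equiv] complementary_mod_def)
  then show ?thesis
    by (auto simp: complemented_elements_def quotient_lattice_def quotient_def)
qed

text \<open>One inclusion between the two sets of classes is automatic, since complements survive in any
  quotient.\<close>

lemma boolean_lifting_iff:
  assumes equiv: "equiv UNIV r"
    and sup: "\<And>x x' y y'. (x, x') \<in> r \<Longrightarrow> (y, y') \<in> r \<Longrightarrow> (sup x y, sup x' y') \<in> r"
    and inf: "\<And>x x' y y'. (x, x') \<in> r \<Longrightarrow> (y, y') \<in> r \<Longrightarrow> (inf x y, inf x' y') \<in> r"
  shows "boolean_lifting r \<longleftrightarrow>
    (\<forall>x y. complementary_mod r x y \<longrightarrow> (\<exists>e e'. complementary_mod Id e e' \<and> (x, e) \<in> r))"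
proof -
  have "complementary_mod r e e'" if "complementary_mod Id e e'" for e e'
    using that equiv by (auto simp: complementary_mod_def equiv_def refl_on_def)
  then have lifts: "{r `` {e} |e. \<exists>e'. complementary_mod Id e e'}
      \<subseteq> {r `` {x} |x. \<exists>y. complementary_mod r x y}"
    by blast
  have subset_Collect: "{f x |x. P x} \<subseteq> S \<longleftrightarrow> (\<forall>x. P x \<longrightarrow> f x \<in> S)"
    for f :: "'a \<Rightarrow> 'a set" and P S
    by blast
  have "boolean_lifting r \<longleftrightarrow>
      {r `` {x} |x. \<exists>y. complementary_mod r x y} = {r `` {e} |e. \<exists>e'. complementary_mod Id e e'}"
    by (simp add: boolean_lifting_def complemented_elements_quotient_lattice[OF assms]
        complemented_elements_lattice_of_type)
  also have "\<dots> \<longleftrightarrow>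
      {r `` {x} |x. \<exists>y. complementary_mod r x y} \<subseteq> {r `` {e} |e. \<exists>e'. complementary_mod Id e e'}"
    using lifts by (simp only: set_eq_subset simp_thms)
  also have "\<dots> \<longleftrightarrow> (\<forall>x. (\<exists>y. complementary_mod r x y) \<longrightarrow>
      r `` {x} \<in> {r `` {e} |e. \<exists>e'. complementary_mod Id e e'})"
    by (rule subset_Collect)
  also have "\<dots> \<longleftrightarrow> (\<forall>x y. complementary_mod r x y \<longrightarrow>
      (\<exists>e e'. complementary_mod Id e e' \<and> r `` {x} = r `` {e}))"
    by (simp only: mem_Collect_eq ex_simps all_simps conj_commute)
  finally show ?thesis
    by (simp only: eq_equiv_class_iff[OF equiv UNIV_I UNIV_I])
qed

lemma boolean_lifting_residuated_iff:
  assumes F: "residuated_filter F"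
  shows "boolean_lifting (residuated_cong F) \<longleftrightarrow> (\<forall>x y. complementary_mod (residuated_cong F) x y \<longrightarrow>
    (\<exists>e e'. complementary_mod Id e e' \<and> (x, e) \<in> residuated_cong F))"
  by (intro boolean_lifting_iff residuated_cong_equiv residuated_cong_compatible F)

lemma boolean_lifting_lattice_iff:
  assumes G: "lattice_filter G"
  shows "boolean_lifting (lattice_cong G) \<longleftrightarrow> (\<forall>u v. complementary_mod (lattice_cong G) u v \<longrightarrow>
    (\<exists>e e'. complementary_mod Id e e' \<and> (u, e) \<in> lattice_cong G))"
  by (intro boolean_lifting_iff lattice_cong_equiv lattice_cong_compatible G)

lemma lattice_cong_top_iff: "lattice_filter G \<Longrightarrow> (u, top) \<in> lattice_cong G \<longleftrightarrow> u \<in> G"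
  unfolding lattice_cong_def lattice_filter_def by (auto simp: inf.absorb_iff2 intro: inf_idem)

lemma residuated_cong_top_iff:
  assumes "residuated_filter F"
  shows "(x, top) \<in> residuated_cong F \<longleftrightarrow> x \<in> F"
proof
  assume "(x, top) \<in> residuated_cong F"
  then obtain f where "f \<in> F" "f * 1 \<le> x"
    unfolding residuated_cong_iff[OF assms] one_eq_top by blast
  then show "x \<in> F" using assms by (auto simp: residuated_filter_def)
next
  assume "x \<in> F"
  moreover have "x * x \<le> top" "x * 1 \<le> x" by simp_all
  ultimately show "(x, top) \<in> residuated_cong F"
    unfolding residuated_cong_iff[OF assms] one_eq_top by blast
qed

section \<open>Complements modulo a filter of a residuated lattice\<close>

text \<open>Multiplication by \<open>a\<close> is a lower adjoint, hence preserves joins.\<close>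

lemma mult_sup_distrib:
  fixes a b c :: "'a::residuated_lattice"
  shows "a * sup b c = sup (a * b) (a * c)"
proof (rule antisym)
  have "b \<le> residuum a (sup (a * b) (a * c))" "c \<le> residuum a (sup (a * b) (a * c))"
    by (simp_all add: residuation mult.commute)
  then have "sup b c \<le> residuum a (sup (a * b) (a * c))" by simp
  then show "a * sup b c \<le> sup (a * b) (a * c)" by (simp add: residuation mult.commute)
qed (simp add: residuated_mult_mono)

lemma residuated_filter_power: "0 < n \<Longrightarrow> residuated_filter F \<Longrightarrow> f \<in> F \<Longrightarrow> f ^ n \<in> F"
  by (induction n rule: nat_induct_non_zero) (simp_all add: residuated_filter_def)

text \<open>Multiplication and meet give the same notion of disjointness once the join of \<open>x\<close> and \<open>y\<close> is in
  the filter, because \<open>(x \<and> y) \<odot> (x \<or> y) \<le> x \<odot> y\<close>. The form with \<open>\<odot>\<close> is the one that is compatible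
  with taking powers.\<close>

lemma complementary_mod_residuated_iff:
  fixes x y :: "'a::residuated_lattice"
  assumes F: "residuated_filter F"
  shows "complementary_mod (residuated_cong F) x y \<longleftrightarrow>
    sup x y \<in> F \<and> (\<exists>f\<in>F. f * (x * y) = bot)"
proof -
  have "(\<exists>f\<in>F. f * inf x y = bot) \<longleftrightarrow> (\<exists>f\<in>F. f * (x * y) = bot)" if s: "sup x y \<in> F"
  proof
    have "x * y \<le> inf x y" by (simp add: residuated_mult_le)
    then show "\<exists>f\<in>F. f * inf x y = bot \<Longrightarrow> \<exists>f\<in>F. f * (x * y) = bot"
      by (metis bot_unique order_refl residuated_mult_mono)
  next
    assume "\<exists>f\<in>F. f * (x * y) = bot"
    then obtain f where f: "f \<in> F" "f * (x * y) = bot" by blast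
    have "inf x y * sup x y \<le> sup (y * x) (x * y)"
      unfolding mult_sup_distrib by (intro sup_mono residuated_mult_mono) simp_all
    then have "f * (inf x y * sup x y) \<le> f * (x * y)"
      by (simp add: mult.commute residuated_mult_mono)
    then have "(f * sup x y) * inf x y = bot"
      using f by (simp add: ac_simps bot_unique)
    moreover have "f * sup x y \<in> F" using F f s by (simp add: residuated_filter_def)
    ultimately show "\<exists>f\<in>F. f * inf x y = bot" by blast
  qed
  moreover have "(inf x y, bot) \<in> residuated_cong F \<longleftrightarrow> (\<exists>f\<in>F. f * inf x y = bot)"
  proof -
    have "f * bot \<le> inf x y" for f by (rule order_trans[OF residuated_mult_le(2)]) simp
    then show ?thesis unfolding residuated_cong_iff[OF F] by (simp add: bot_unique)
  qed
  ultimately show ?thesis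
    unfolding complementary_mod_def residuated_cong_top_iff[OF F] by blast
qed

text \<open>Modulo the filter, \<open>x = x \<odot> (x \<or> y) = x\<^sup>2 \<or> x \<odot> y = x\<^sup>2\<close>.\<close>

lemma complementary_mod_idempotent:
  fixes x y :: "'a::residuated_lattice"
  assumes F: "residuated_filter F" and xy: "complementary_mod (residuated_cong F) x y"
    and "0 < n"
  shows "\<exists>f\<in>F. f * x \<le> x ^ n"
proof -
  obtain f where f: "f \<in> F" "f * (x * y) = bot" and s: "sup x y \<in> F"
    using xy unfolding complementary_mod_residuated_iff[OF F] by blast
  define h where "h = f * sup x y"
  have h: "h \<in> F" using F f s by (simp add: h_def residuated_filter_def)
  have "h * x = f * (x * sup x y)" by (simp add: h_def ac_simps)
  also have "\<dots> = f * (x * x)" by (simp add: mult_sup_distrib f)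
  finally have hx: "h * x \<le> x * x" by (simp add: residuated_mult_le)
  have "h ^ n * x \<le> x ^ n"
    using \<open>0 < n\<close>
  proof (induction n rule: nat_induct_non_zero)
    case 1
    show ?case by (simp add: residuated_mult_le)
  next
    case (Suc n)
    have "h ^ Suc n * x = h ^ n * (h * x)" by (simp add: ac_simps)
    also have "\<dots> \<le> h ^ n * (x * x)" using hx by (simp add: residuated_mult_mono)
    also have "\<dots> = (h ^ n * x) * x" by (simp add: ac_simps)
    also have "\<dots> \<le> x ^ n * x" using Suc.IH by (simp add: residuated_mult_mono)
    finally show ?case by (simp add: ac_simps)
  qed
  then show ?thesis using residuated_filter_power[OF \<open>0 < n\<close> F h] by blast
qed

section \<open>Passing to the reticulation\<close>

context
  fixes l :: "'a::residuated_lattice \<Rightarrow> 'b::{distrib_lattice, bounded_lattice}"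
  assumes ret: "is_reticulation l"
begin

lemma reticulation_surj: "\<exists>x. u = l x"
  using ret by (auto simp: is_reticulation_def surj_def)

lemma reticulation_hom:
  "l (x * y) = inf (l x) (l y)" "l (sup x y) = sup (l x) (l y)" "l bot = bot" "l top = top"
  using ret by (simp_all add: is_reticulation_def)

lemma reticulation_le_iff: "l x \<le> l y \<longleftrightarrow> (\<exists>n>0. x ^ n \<le> y)"
  using ret by (simp add: is_reticulation_def)

lemma reticulation_mono: "x \<le> y \<Longrightarrow> l x \<le> l y"
  unfolding reticulation_le_iff by (rule exI[of _ 1]) simp

text \<open>The preservation of meets is forced: \<open>x \<odot> y \<le> x \<and> y\<close>, and the image of \<open>x \<odot> y\<close> is already
  \<open>\<lambda>(x) \<and> \<lambda>(y)\<close>.\<close>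

lemma reticulation_inf: "l (inf x y) = inf (l x) (l y)"
proof (rule antisym)
  have "l (x * y) \<le> l (inf x y)" by (simp add: reticulation_mono residuated_mult_le)
  then show "inf (l x) (l y) \<le> l (inf x y)" by (simp add: reticulation_hom)
qed (simp add: reticulation_mono)

lemma reticulation_power: "0 < n \<Longrightarrow> l (x ^ n) = l x"
  by (induction n rule: nat_induct_non_zero) (simp_all add: reticulation_hom)

lemma residuated_filter_vimage:
  assumes G: "lattice_filter G"
  shows "residuated_filter (l -` G)"
proof -
  obtain u x where "u \<in> G" "u = l x"
    using G reticulation_surj unfolding lattice_filter_def by blast
  then have "x \<in> l -` G" by simp
  moreover have "a * b \<in> l -` G" if "a \<in> l -` G" "b \<in> l -` G" for a b
    using that G by (simp add: reticulation_hom lattice_filter_def)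
  moreover have "b \<in> l -` G" if "a \<in> l -` G" "a \<le> b" for a b
    using that G reticulation_mono[of a b] by (auto simp: lattice_filter_def)
  ultimately show ?thesis unfolding residuated_filter_def by blast
qed

text \<open>The filter \<open>G\<close> is the image of \<open>F\<close>. A filter contains with \<open>f\<close> all powers of \<open>f\<close>, hence every \<open>x\<close>
  with \<open>\<lambda>(f) \<le> \<lambda>(x)\<close>, so \<open>F\<close> is saturated with respect to \<open>\<lambda>\<close>.\<close>

lemma residuated_filter_eq_vimage:
  assumes F: "residuated_filter F"
  obtains G where "lattice_filter G" and "F = l -` G"
proof
  have up: "x \<in> F" if "f \<in> F" "l f \<le> l x" for f x
    using that F residuated_filter_power[OF _ F] unfolding reticulation_le_iff
    by (auto simp: residuated_filter_def)
  then show "F = l -` l ` F" by force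
  have "inf u v \<in> l ` F" if "u \<in> l ` F" "v \<in> l ` F" for u v
    using that F by (auto simp: residuated_filter_def simp flip: reticulation_hom)
  moreover have "v \<in> l ` F" if "u \<in> l ` F" "u \<le> v" for u v
    using that up reticulation_surj[of v] by auto
  ultimately show "lattice_filter (l ` F)"
    using F by (auto simp: lattice_filter_def residuated_filter_def)
qed

lemma reticulation_cong:
  assumes G: "lattice_filter G" and xy: "(x, y) \<in> residuated_cong (l -` G)"
  shows "(l x, l y) \<in> lattice_cong G"
proof -
  obtain f where f: "l f \<in> G" "f * x \<le> y" "f * y \<le> x"
    using xy unfolding residuated_cong_iff[OF residuated_filter_vimage[OF G]] by auto
  then have "inf (l f) (l x) \<le> l y" "inf (l f) (l y) \<le> l x"
    using reticulation_mono by (simp_all flip: reticulation_hom)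
  then have "inf (l x) (l f) = inf (l y) (l f)"
    by (simp add: antisym inf_commute)
  then show ?thesis using f by (auto simp: lattice_cong_def)
qed

lemma reticulation_complementary:
  assumes G: "lattice_filter G" and xy: "complementary_mod (residuated_cong (l -` G)) x y"
  shows "complementary_mod (lattice_cong G) (l x) (l y)"
proof -
  have "(l (sup x y), l top) \<in> lattice_cong G" "(l (inf x y), l bot) \<in> lattice_cong G"
    using xy reticulation_cong[OF G] by (simp_all add: complementary_mod_def)
  then show ?thesis by (simp add: complementary_mod_def reticulation_hom reticulation_inf)
qed

text \<open>From \<open>\<lambda>(f \<odot> x \<odot> y) = 0\<close> one only learns that a power of \<open>f \<odot> x \<odot> y\<close> is \<open>0\<close>, whence the
  exponent. The join stays in the filter because \<open>x\<^sup>n \<or> y\<^sup>n\<close> and \<open>x \<or> y\<close> have the same image.\<close>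

lemma reticulation_complementary_powers:
  assumes G: "lattice_filter G" and xy: "complementary_mod (lattice_cong G) (l x) (l y)"
  obtains n where "0 < n" and "complementary_mod (residuated_cong (l -` G)) (x ^ n) (y ^ n)"
proof -
  have s: "sup (l x) (l y) \<in> G"
    using xy by (simp add: complementary_mod_def lattice_cong_top_iff[OF G])
  obtain f where f: "l f \<in> G" "inf (inf (l x) (l y)) (l f) = bot"
    using xy reticulation_surj by (auto simp: complementary_mod_def lattice_cong_def) metis
  then have "l (f * (x * y)) \<le> l bot"
    by (simp add: reticulation_hom inf_commute)
  then obtain n where n: "0 < n" "f ^ n * (x ^ n * y ^ n) = bot"
    unfolding reticulation_le_iff by (auto simp: bot_unique power_mult_distrib)
  have "sup (x ^ n) (y ^ n) \<in> l -` G" "f ^ n \<in> l -` G"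
    using s f n by (simp_all add: reticulation_hom reticulation_power)
  then have "complementary_mod (residuated_cong (l -` G)) (x ^ n) (y ^ n)"
    unfolding complementary_mod_residuated_iff[OF residuated_filter_vimage[OF G]] using n by blast
  with n that show thesis by blast
qed

text \<open>The congruence of the images says that \<open>g\<^sup>n \<odot> x\<^sup>n \<le> y\<close> for some \<open>g\<close> in the filter. Since \<open>x\<close> is
  idempotent modulo the filter, the exponent of \<open>x\<close> can be dropped.\<close>

lemma reticulation_cong_reflect:
  assumes G: "lattice_filter G"
    and x: "complementary_mod (residuated_cong (l -` G)) x x'"
    and y: "complementary_mod (residuated_cong (l -` G)) y y'"
    and xy: "(l x, l y) \<in> lattice_cong G"
  shows "(x, y) \<in> residuated_cong (l -` G)"
proof -
  let ?F = "l -` G"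
  note F = residuated_filter_vimage[OF G]
  obtain g where g: "g \<in> ?F" "inf (l x) (l g) = inf (l y) (l g)"
    using xy reticulation_surj by (auto simp: lattice_cong_def) metis
  have below: "\<exists>f\<in>?F. f * a \<le> b"
    if a: "complementary_mod (residuated_cong ?F) a a'" and ab: "inf (l a) (l g) \<le> l b" for a a' b
  proof -
    have "l (g * a) \<le> l b" using ab by (simp add: reticulation_hom inf_commute)
    then obtain n where n: "0 < n" "g ^ n * a ^ n \<le> b"
      unfolding reticulation_le_iff by (auto simp: power_mult_distrib)
    obtain f where f: "f \<in> ?F" "f * a \<le> a ^ n"
      using complementary_mod_idempotent[OF F a n(1)] by blast
    have "(g ^ n * f) * a \<le> g ^ n * a ^ n"
      using f by (simp add: mult.assoc residuated_mult_mono)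
    also note n(2)
    finally have "(g ^ n * f) * a \<le> b" .
    moreover have "g ^ n * f \<in> ?F"
      using F f residuated_filter_power[OF n(1) F g(1)] by (simp add: residuated_filter_def)
    ultimately show ?thesis by blast
  qed
  obtain f where f: "f \<in> ?F" "f * x \<le> y"
    using below[OF x, of y] g(2) by auto
  obtain h where h: "h \<in> ?F" "h * y \<le> x"
    using below[OF y, of x] g(2) by (metis inf.cobounded1)
  have "(f * h) * x \<le> f * x" "(f * h) * y \<le> h * y"
    by (simp_all add: residuated_mult_mono residuated_mult_le)
  then have "(f * h) * x \<le> y" "(f * h) * y \<le> x"
    using f h order_trans by blast+
  moreover have "f * h \<in> ?F" using F f h by (simp add: residuated_filter_def)
  ultimately show ?thesis unfolding residuated_cong_iff[OF F] by blast
qed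

text \<open>The least filter \<open>{1}\<close> has the identity as its congruence, both in \<open>\<L>(A)\<close> and, after pulling it
  back, in \<open>A\<close>. This makes the facts about complements in \<open>A\<close> and \<open>\<L>(A)\<close> themselves instances of those
  about quotients.\<close>

lemma lattice_filter_top: "lattice_filter {top :: 'b}"
  by (simp add: lattice_filter_def top_unique)

lemma lattice_cong_top: "lattice_cong {top :: 'b} = Id"
  by (auto simp: lattice_cong_def)

lemma residuated_cong_vimage_top: "residuated_cong (l -` {top}) = Id"
proof -
  have "x = top" if "l x = top" for x
    using that reticulation_le_iff[of top x]
    by (auto simp: reticulation_hom top_unique power_one[where 'a='a, unfolded one_eq_top])
  then have "l -` {top} = {top}" by (auto simp: reticulation_hom)
  then show ?thesis
    using residuated_cong_iff[OF residuated_filter_vimage[OF lattice_filter_top]]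
    by (auto simp flip: one_eq_top)
qed

lemma reticulation_complements:
  "complementary_mod Id e e' \<Longrightarrow> complementary_mod Id (l e) (l e')"
  using reticulation_complementary[OF lattice_filter_top]
  by (simp add: residuated_cong_vimage_top lattice_cong_top)

lemma reticulation_complements_lift:
  assumes "complementary_mod Id u u'"
  obtains e e' where "complementary_mod Id e e'" and "l e = u"
proof -
  obtain x y where "u = l x" "u' = l y" using reticulation_surj by metis
  then show thesis
    using reticulation_complementary_powers[OF lattice_filter_top, of x y] assms that
      reticulation_power
    by (metis residuated_cong_vimage_top lattice_cong_top)
qed

text \<open>In both directions, complements in the given quotient are moved along \<open>\<lambda>\<close> to the other one,
  lifted there, and the lift is moved back. From \<open>A\<close> to \<open>\<L>(A)\<close> congruence is preserved, and from \<open>\<L>(A)\<close>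
  back to \<open>A\<close> it is reflected because both elements are complemented modulo the filter.\<close>

lemma boolean_lifting_reticulation_iff:
  assumes G: "lattice_filter G"
  shows "boolean_lifting (residuated_cong (l -` G)) \<longleftrightarrow> boolean_lifting (lattice_cong G)"
proof -
  let ?R = "residuated_cong (l -` G)" and ?S = "lattice_cong G"
  note F = residuated_filter_vimage[OF G]
  show ?thesis
    unfolding boolean_lifting_residuated_iff[OF F] boolean_lifting_lattice_iff[OF G]
  proof (intro iffI allI impI)
    fix u v
    assume lift: "\<forall>x y. complementary_mod ?R x y \<longrightarrow>
        (\<exists>e e'. complementary_mod Id e e' \<and> (x, e) \<in> ?R)"
      and uv: "complementary_mod ?S u v"
    obtain x y where xy: "u = l x" "v = l y" using reticulation_surj by metis
    obtain n where "0 < n" "complementary_mod ?R (x ^ n) (y ^ n)"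
      using reticulation_complementary_powers[OF G] uv xy by metis
    then obtain e e' where "complementary_mod Id e e'" "(x ^ n, e) \<in> ?R"
      using lift by blast
    then show "\<exists>e e'. complementary_mod Id e e' \<and> (u, e) \<in> ?S"
      using reticulation_cong[OF G] reticulation_complements reticulation_power[OF \<open>0 < n\<close>] xy
      by metis
  next
    fix x y
    assume lift: "\<forall>u v. complementary_mod ?S u v \<longrightarrow>
        (\<exists>e e'. complementary_mod Id e e' \<and> (u, e) \<in> ?S)"
      and xy: "complementary_mod ?R x y"
    obtain u u' where u: "complementary_mod Id u u'" "(l x, u) \<in> ?S"
      using lift reticulation_complementary[OF G xy] by blast
    obtain e e' where e: "complementary_mod Id e e'" "l e = u"
      using reticulation_complements_lift[OF u(1)] .
    have "complementary_mod ?R e e'"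
      using e(1) residuated_cong_equiv[OF F]
      by (auto simp: complementary_mod_def equiv_def refl_on_def)
    then have "(x, e) \<in> ?R"
      using reticulation_cong_reflect[OF G xy] u(2) e(2) by blast
    with e(1) show "\<exists>e e'. complementary_mod Id e e' \<and> (x, e) \<in> ?R" by blast
  qed
qed

end

theorem proposition5p19:
  fixes l :: "'a::residuated_lattice \<Rightarrow> 'b::{distrib_lattice, bounded_lattice}"
  assumes "is_reticulation l"
  shows "residuated_BLP TYPE('a) \<longleftrightarrow> lattice_BLP TYPE('b)"
proof
  assume A: "residuated_BLP TYPE('a)"
  have "boolean_lifting (lattice_cong G)" if G: "lattice_filter G" for G :: "'b set"
    using A residuated_filter_vimage[OF assms G] boolean_lifting_reticulation_iff[OF assms G]
    by (auto simp: residuated_BLP_def)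
  then show "lattice_BLP TYPE('b)" by (simp add: lattice_BLP_def)
next
  assume L: "lattice_BLP TYPE('b)"
  have "boolean_lifting (residuated_cong F)" if F: "residuated_filter F" for F :: "'a set"
  proof -
    obtain G where G: "lattice_filter G" and FG: "F = l -` G"
      using residuated_filter_eq_vimage[OF assms F] .
    have "boolean_lifting (lattice_cong G)"
      using L G by (simp add: lattice_BLP_def)
    then show ?thesis
      unfolding FG boolean_lifting_reticulation_iff[OF assms G] .
  qed
  then show "residuated_BLP TYPE('a)" by (simp add: residuated_BLP_def)
qed

end
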